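(* Let $q>2$ be a prime power and let $s\geq 3$ be an odd number. If $f\in KE(C_s)$ has exactly $r$ non-zero terms with $r\in\{1,2,\dots,s\}$, then $$|V_{(\mathbb{F}_q^* )^s}(f)|=\sum_{i=1}^{r-1}(-1)^{i+1}(q-1)^{s-i}.$$ Then the weight distribution of $\mathcal{C}_{C_s}$ is as follows: $$A_{\sum_{i=0}^{r-1}(-1)^i(q-1)^{s-i}}(\mathcal{C}_{C_s})=\binom{s}{r}(q-1)^r\quad\text{for every } r\in\{1,2,\dots,s\},$$ and $A_j(\mathcal{C}_{C_s})=0$ for the remaining values of $j\ge1$. Consequently, the minimum distance of $\mathcal{C}_{C_s}$ corresponds to $r=2$, that is, $\delta(\mathcal{C}_{C_s})=(q-1)^{s-1}(q-2)$, and it is achieved with all polynomials $f\in KE(C_s)$ with exactly two non-zero terms.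
   Context: $K=\mathbb{F}_q$ is the finite field with $q$ elements and $\mathbb{F}_q^*=\mathbb{F}_q\setminus\{0\}$. $C_s$ is the cycle of length $s$, with vertices $t_1,\dots,t_s$ and edges $\{t_i,t_{i+1}\}$ ($1\le i\le s-1$) and $\{t_1,t_s\}$. For a finite simple graph $G$ on $\{t_1,\dots,t_s\}$ with edge set $E$, the vertices are also regarded as variables and $KE(G)=\mathrm{span}_K\{t_it_j : \{t_i,t_j\}\in E\}\subseteq K[t_1,\dots,t_s]$. The number of non-zero terms of $f\in KE(G)$ is the number of edge monomials having non-zero coefficient in $f$. Put $T=(\mathbb{F}_q^* )^s=\{P_1,\dots,P_{|T|}\}$, $|T|=(q-1)^s$, and $V_T(f)=\{P\in T: f(P)=0\}$. The edge code of $G$ is $\mathcal{C}_G=\{(f(P_1),\dots,f(P_{|T|})): f\in KE(G)\}\subseteq K^{|T|}$. The Hamming weight of a codeword is its number of non-zero coordinates; $A_i(\mathcal{C}_G)$ is the number of codewords of Hamming weight $i$ ($1\le i\le |T|$), the weight distribution is $(A_1(\mathcal{C}_G),\dots,A_{|T|}(\mathcal{C}_G))$, and the minimum distance $\delta(\mathcal{C}_G)$ is the smallest $i\ge1$ with $A_i(\mathcal{C}_G)\neq 0$. Empty sums are $0$. *)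

theory Defs
  imports "HOL-Library.Poly_Mapping" "HOL-Library.FuncSet" "HOL-Library.Cardinality" "HOL-Number_Theory.Prime_Powers"
begin

section \<open>Polynomials in the variables t_0, t_1, \<dots>\<close>

text \<open>A monomial is its finitely supported exponent vector, and a polynomial is the finitely
  supported map from monomials to coefficients; the product of Poly_Mapping is the polynomial
  product.\<close>

type_synonym monomial = "nat \<Rightarrow>\<^sub>0 nat"
type_synonym 'a mpoly = "monomial \<Rightarrow>\<^sub>0 'a"

definition mpoly_scale :: "'a::field \<Rightarrow> 'a mpoly \<Rightarrow> 'a mpoly" where
  "mpoly_scale c f = Poly_Mapping.single 0 c * f"

definition mpoly_eval :: "(nat \<Rightarrow> 'a::field) \<Rightarrow> 'a mpoly \<Rightarrow> 'a" where
  "mpoly_eval P f = (\<Sum>m\<in>Poly_Mapping.keys f. Poly_Mapping.lookup f m *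
     (\<Prod>v\<in>Poly_Mapping.keys m. P v ^ Poly_Mapping.lookup m v))"

lemma vector_space_mpoly: "vector_space (mpoly_scale :: 'a::field \<Rightarrow> _)"
  by unfold_locales
    (simp_all add: mpoly_scale_def algebra_simps single_add mult_single flip: mult.assoc)


section \<open>Edge polynomials of a graph\<close>

text \<open>A graph on the vertices t_1, \<dots>, t_s is given by its set of edges, each edge being the
  set of the indices of its two ends.\<close>

definition simple_graph :: "nat \<Rightarrow> nat set set \<Rightarrow> bool" where
  "simple_graph s E \<longleftrightarrow> (\<forall>e\<in>E. e \<subseteq> {1..s} \<and> card e = 2)"

definition cycle_edges :: "nat \<Rightarrow> nat set set" where
  "cycle_edges s = {{i, i + 1} | i. 1 \<le> i \<and> i \<le> s - 1} \<union> {{1, s}}"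

lemma simple_graph_cycle: "s \<ge> 3 \<Longrightarrow> simple_graph s (cycle_edges s)"
  by (auto simp: simple_graph_def cycle_edges_def)

definition edge_monomials :: "nat set set \<Rightarrow> monomial set" where
  "edge_monomials E =
     {Poly_Mapping.single i 1 + Poly_Mapping.single j 1 | i j. i \<noteq> j \<and> {i, j} \<in> E}"

definition edge_space :: "nat set set \<Rightarrow> 'a::field mpoly set" where
  "edge_space E = module.span mpoly_scale ((\<lambda>m. Poly_Mapping.single m 1) ` edge_monomials E)"

definition num_nonzero_terms :: "nat set set \<Rightarrow> 'a::field mpoly \<Rightarrow> nat" where
  "num_nonzero_terms E f = card {m \<in> edge_monomials E. Poly_Mapping.lookup f m \<noteq> 0}"


section \<open>Edge codes\<close>

definition torus :: "nat \<Rightarrow> (nat \<Rightarrow> 'a::field) set" where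
  "torus s = {1..s} \<rightarrow>\<^sub>E (UNIV - {0})"

definition torus_zeros :: "nat \<Rightarrow> 'a::field mpoly \<Rightarrow> (nat \<Rightarrow> 'a) set" where
  "torus_zeros s f = {P \<in> torus s. mpoly_eval P f = 0}"

text \<open>The list Ps enumerates the evaluation points; a codeword is a list of the same length.\<close>

definition evaluation_word :: "(nat \<Rightarrow> 'a::field) list \<Rightarrow> 'a mpoly \<Rightarrow> 'a list" where
  "evaluation_word Ps f = map (\<lambda>P. mpoly_eval P f) Ps"

definition edge_code :: "(nat \<Rightarrow> 'a::field) list \<Rightarrow> nat set set \<Rightarrow> 'a list set" where
  "edge_code Ps E = evaluation_word Ps ` edge_space E"

definition hamming_weight :: "'a::zero list \<Rightarrow> nat" where
  "hamming_weight c = card {i. i < length c \<and> c ! i \<noteq> 0}"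

definition weight_count :: "'a::zero list set \<Rightarrow> nat \<Rightarrow> nat" where
  "weight_count C i = card {c \<in> C. hamming_weight c = i}"

definition min_distance :: "'a::zero list set \<Rightarrow> nat" where
  "min_distance C = (LEAST i. i \<ge> 1 \<and> weight_count C i \<noteq> 0)"

text \<open>The candidate weight is an alternating sum, hence formed in the integers; for q > 2 and
  1 \<le> r \<le> s its terms decrease in absolute value, so the sum is positive and the conversion
  to a natural number loses nothing.\<close>

definition cycle_weight :: "nat \<Rightarrow> nat \<Rightarrow> nat \<Rightarrow> nat" where
  "cycle_weight q s r = nat (\<Sum>i=0..r - 1. (- 1) ^ i * (int q - 1) ^ (s - i))"

end

theory Submission
  imports Defs
begin

text \<open>
  Let \<open>n = q - 1\<close>. An edge polynomial of the cycle is \<open>f = \<Sum>i. c i * t\<^sub>i * t\<^sub>i\<^sub>+\<^sub>1\<close> with indices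
  modulo \<open>s\<close>. The substitution \<open>y\<^sub>i = t\<^sub>i * t\<^sub>i\<^sub>+\<^sub>1\<close> would turn \<open>f\<close> into a linear form, but it is
  not a bijection of the torus when \<open>q\<close> is odd. It becomes one after adding a scalar: for odd
  \<open>s\<close> the map \<open>(l, t) \<mapsto> (t\<^sub>1, (l * t\<^sub>i * t\<^sub>i\<^sub>+\<^sub>1)\<^sub>i)\<close> is a permutation of the product of
  the multiplicative group with the torus. The scalar \<open>l\<close> does not affect the vanishing of \<open>f\<close>,
  so \<open>f\<close> has as many non-zeros on the torus as the linear form \<open>\<Sum>i. c i * y\<^sub>i\<close>
  (lemma \<open>card_cycle_form_nonzeros\<close>).

  For a linear form the count is elementary: solving for one variable with non-zero coefficient
  gives a recursion on the number of variables, whose solution is the alternating sum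
  \<open>n^s - n^(s-1) + \<dots>\<close> with as many summands as there are non-zero coefficients
  (lemma \<open>card_linear_form_nonzeros\<close>). Hence the weight of a codeword depends only on the number
  \<open>r\<close> of non-zero terms. Since \<open>(n + 1)\<close> times this sum is \<open>n^(s+1) - (-1)^r * n^(s+1-r)\<close>, the
  weights for \<open>r = 1, \<dots>, s\<close> are positive and pairwise distinct, with the smallest one at
  \<open>r = 2\<close>. Positivity makes evaluation injective, so that the codewords of a given weight are
  counted by the choices of \<open>r\<close> out of \<open>s\<close> monomials and of their non-zero coefficients.
\<close>

section \<open>Alternating sums of powers\<close>

definition alt_sum :: "int \<Rightarrow> nat \<Rightarrow> nat \<Rightarrow> int" where
  "alt_sum n s r = (\<Sum>i<r. (- 1) ^ i * n ^ (s - i))"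

lemma alt_sum_0 [simp]: "alt_sum n s 0 = 0"
  by (simp add: alt_sum_def)

lemma alt_sum_Suc_left:
  assumes "r \<le> s"
  shows "alt_sum n (Suc s) r = n * alt_sum n s r"
proof -
  have "(- 1) ^ i * n ^ (Suc s - i) = n * ((- 1) ^ i * n ^ (s - i))" if "i < r" for i
    using that assms by (simp add: Suc_diff_le)
  then show ?thesis
    unfolding alt_sum_def sum_distrib_left by (intro sum.cong) auto
qed

lemma alt_sum_Suc_Suc: "alt_sum n (Suc s) (Suc r) = n ^ Suc s - alt_sum n s r"
  by (simp add: alt_sum_def sum.lessThan_Suc_shift sum_negf del: sum.lessThan_Suc)

lemma alt_sum_closed_form:
  assumes "r \<le> s"
  shows "(n + 1) * alt_sum n s r = n ^ Suc s - (- 1) ^ r * n ^ (Suc s - r)"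
  using assms
proof (induction r)
  case (Suc r)
  have "(n + 1) * alt_sum n s (Suc r) = (n + 1) * alt_sum n s r + (n + 1) * ((- 1) ^ r * n ^ (s - r))"
    by (simp add: alt_sum_def algebra_simps)
  also have "\<dots> = n ^ Suc s - (- 1) ^ r * n ^ (Suc s - r) + (n + 1) * ((- 1) ^ r * n ^ (s - r))"
    using Suc by simp
  also have "n ^ (Suc s - r) = n * n ^ (s - r)"
    using Suc.prems by (simp add: Suc_diff_le)
  finally show ?case by (simp add: algebra_simps)
qed simp

lemma alt_sum_pos:
  assumes "n \<ge> 2" "1 \<le> r" "r \<le> s"
  shows "alt_sum n s r > 0"
proof -
  have "(- 1) ^ r * n ^ (Suc s - r) \<le> n ^ (Suc s - r)"
    using assms by (cases "even r") auto
  also have "\<dots> < n ^ Suc s"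
    using assms by (intro power_strict_increasing) auto
  finally have "(n + 1) * alt_sum n s r > 0"
    using alt_sum_closed_form[OF assms(3), of n] by simp
  then show ?thesis using assms(1) by (simp add: zero_less_mult_iff)
qed

text \<open>By the closed form, \<open>(n + 1) * alt_sum n s r\<close> deviates from \<open>n ^ Suc s\<close> by an integer of
  absolute value \<open>n ^ (Suc s - r)\<close>, from which \<open>r\<close> can be read off.\<close>

lemma inj_on_alt_sum:
  assumes "n \<ge> 2"
  shows "inj_on (alt_sum n s) {..s}"
proof (rule inj_onI)
  fix a b assume ab: "a \<in> {..s}" "b \<in> {..s}" "alt_sum n s a = alt_sum n s b"
  then have "(- 1) ^ a * n ^ (Suc s - a) = (- 1) ^ b * n ^ (Suc s - b)"
    using alt_sum_closed_form[of a s n] alt_sum_closed_form[of b s n] by simp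
  then have "\<bar>(- 1) ^ a * n ^ (Suc s - a)\<bar> = \<bar>(- 1) ^ b * n ^ (Suc s - b)\<bar>"
    by simp
  then have "n ^ (Suc s - a) = n ^ (Suc s - b)"
    using assms by (simp add: abs_mult power_abs)
  then have "Suc s - a = Suc s - b"
    using assms by (subst (asm) power_inject_exp) auto
  then show "a = b" using ab by simp
qed

text \<open>Odd \<open>r\<close> give values above \<open>n ^ Suc s / (n + 1)\<close>, even ones values below it, and the deviation
  shrinks as \<open>r\<close> grows.\<close>

lemma alt_sum_2_le:
  assumes "n \<ge> 2" "1 \<le> r" "r \<le> s" "2 \<le> s"
  shows "alt_sum n s 2 \<le> alt_sum n s r"
proof -
  have "(- 1) ^ r * n ^ (Suc s - r) \<le> n ^ (Suc s - 2)"
  proof (cases "even r")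
    case True
    then have "r \<ge> 2" using assms by (cases "r = 1") auto
    then have "n ^ (Suc s - r) \<le> n ^ (Suc s - 2)"
      using assms by (intro power_increasing) auto
    then show ?thesis using True by simp
  next
    case False
    have "0 \<le> n ^ (Suc s - r)" "0 \<le> n ^ (Suc s - 2)"
      using assms by simp_all
    moreover have "(- 1) ^ r * n ^ (Suc s - r) = - (n ^ (Suc s - r))"
      using False by simp
    ultimately show ?thesis by linarith
  qed
  then have "(n + 1) * alt_sum n s 2 \<le> (n + 1) * alt_sum n s r"
    using alt_sum_closed_form[OF assms(3), of n] alt_sum_closed_form[OF assms(4), of n] by simp
  then show ?thesis using assms(1) by simp
qed

lemma alt_sum_2: "s \<ge> 1 \<Longrightarrow> alt_sum n s 2 = n ^ (s - 1) * (n - 1)"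
  by (cases s) (simp_all add: alt_sum_def numeral_2_eq_2 algebra_simps)

lemma cycle_weight_eq_alt_sum:
  assumes "r \<ge> 1"
  shows "cycle_weight q s r = nat (alt_sum (int q - 1) s r)"
proof -
  have "{0..r - 1} = {..<r}" using assms by auto
  then show ?thesis by (simp add: cycle_weight_def alt_sum_def)
qed


section \<open>Non-zeros of linear forms on the torus\<close>

lemma int_card_units: "int (card (UNIV - {0 :: 'a::{field,finite}})) = int CARD('a) - 1"
  by (simp add: card_Diff_singleton of_nat_diff Suc_leI)

text \<open>Split off the last variable \<open>y\<close>. If its coefficient is zero, it is free. Otherwise \<open>y\<close> makes the
  whole form vanish for exactly one non-zero value if the rest of the form is non-zero, and for
  none if the rest is zero; so the zeros of the whole form are as many as the non-zeros of the
  rest.\<close>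

lemma card_linear_form_nonzeros:
  fixes c :: "'b \<Rightarrow> 'a::{field,finite}"
  assumes "finite S"
  shows "int (card {z \<in> S \<rightarrow>\<^sub>E (UNIV - {0}). (\<Sum>i\<in>S. c i * z i) \<noteq> 0}) =
           alt_sum (int CARD('a) - 1) (card S) (card {i \<in> S. c i \<noteq> 0})"
  using assms
proof (induction S rule: finite_induct)
  case empty
  then show ?case by simp
next
  case (insert x S)
  define U where "U = (UNIV - {0 :: 'a})"
  define L where "L z = (\<Sum>i\<in>S. c i * z i)" for z
  define A where "A = {z \<in> S \<rightarrow>\<^sub>E U. L z \<noteq> 0}"
  define r where "r = card {i \<in> S. c i \<noteq> 0}"
  define n where "n = int CARD('a) - 1"
  have finU: "finite U" and finT: "finite (S \<rightarrow>\<^sub>E U)"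
    using insert(1) by (auto simp: finite_PiE U_def)
  have cardU: "int (card U) = n"
    unfolding U_def n_def by (rule int_card_units)
  have IH: "int (card A) = alt_sum n (card S) r"
    using insert.IH by (simp add: A_def U_def L_def r_def n_def)
  have rle: "r \<le> card S"
    unfolding r_def using insert(1) by (intro card_mono) auto
  define g where "g = (\<lambda>(y, z :: 'b \<Rightarrow> 'a). z(x := y))"
  have inj: "inj_on g (U \<times> (S \<rightarrow>\<^sub>E U))"
    unfolding g_def using inj_combinator[OF insert(2), of "\<lambda>_. U"] by simp
  have img: "insert x S \<rightarrow>\<^sub>E U = g ` (U \<times> (S \<rightarrow>\<^sub>E U))"
    unfolding g_def by (rule PiE_insert_eq)
  have form: "(\<Sum>i\<in>insert x S. c i * (z(x := y)) i) = c x * y + L z" for y z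
  proof -
    have "(\<Sum>i\<in>S. c i * (z(x := y)) i) = L z"
      unfolding L_def using insert(2) by (intro sum.cong) auto
    then show ?thesis using insert(1,2) by simp
  qed
  define B where "B = {p \<in> U \<times> (S \<rightarrow>\<^sub>E U). c x * fst p + L (snd p) \<noteq> 0}"
  have form_g: "(\<Sum>i\<in>insert x S. c i * g p i) = c x * fst p + L (snd p)" for p
    unfolding g_def using form[of "snd p" "fst p"] by (simp add: case_prod_beta)
  have "{z \<in> insert x S \<rightarrow>\<^sub>E U. (\<Sum>i\<in>insert x S. c i * z i) \<noteq> 0} = g ` B"
    unfolding img B_def using form_g by auto
  moreover have "card (g ` B) = card B"
    using inj by (intro card_image) (auto simp: B_def intro: inj_on_subset)
  ultimately have cardB: "card {z \<in> insert x S \<rightarrow>\<^sub>E U. (\<Sum>i\<in>insert x S. c i * z i) \<noteq> 0} = card B"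
    by simp
  have "int (card B) = alt_sum n (Suc (card S)) (card {i \<in> insert x S. c i \<noteq> 0})"
  proof (cases "c x = 0")
    case True
    then have "B = U \<times> A" by (auto simp: B_def A_def)
    moreover have "{i \<in> insert x S. c i \<noteq> 0} = {i \<in> S. c i \<noteq> 0}" using True by auto
    ultimately show ?thesis
      using IH cardU rle by (simp add: card_cartesian_product alt_sum_Suc_left r_def)
  next
    case False
    define Z where "Z = {p \<in> U \<times> (S \<rightarrow>\<^sub>E U). c x * fst p + L (snd p) = 0}"
    have "bij_betw (\<lambda>z. (- L z / c x, z)) A Z"
      by (rule bij_betw_byWitness[where f' = snd])
         (use False in \<open>auto simp: A_def Z_def U_def field_simps intro: minus_unique\<close>)
    then have "card Z = card A" by (simp add: bij_betw_same_card)
    moreover have "card B + card Z = card (U \<times> (S \<rightarrow>\<^sub>E U))"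
    proof -
      have "finite B" "finite Z" "B \<inter> Z = {}" "B \<union> Z = U \<times> (S \<rightarrow>\<^sub>E U)"
        unfolding B_def Z_def using finU finT by auto
      then show ?thesis using card_Un_disjoint[of B Z] by simp
    qed
    moreover have "int (card (U \<times> (S \<rightarrow>\<^sub>E U))) = n * n ^ card S"
      using cardU insert(1) by (simp add: card_cartesian_product card_PiE)
    ultimately have "int (card B) = n * n ^ card S - int (card A)"
      by linarith
    moreover have "card {i \<in> insert x S. c i \<noteq> 0} = Suc r"
    proof -
      have "{i \<in> insert x S. c i \<noteq> 0} = insert x {i \<in> S. c i \<noteq> 0}" using False by auto
      then show ?thesis using insert(1,2) by (simp add: r_def)
    qed
    ultimately show ?thesis using IH by (simp add: alt_sum_Suc_Suc)
  qed
  then show ?case using cardB insert(1,2) by (simp add: U_def n_def)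
qed


section \<open>Linearising the quadratic form of an odd cycle\<close>

definition next_vertex :: "nat \<Rightarrow> nat \<Rightarrow> nat" where
  "next_vertex s i = (if i = s then 1 else i + 1)"

lemma next_vertex_range: "i \<in> {1..s} \<Longrightarrow> next_vertex s i \<in> {1..s}"
  by (auto simp: next_vertex_def)

lemma finite_torus: "finite (torus s :: (nat \<Rightarrow> 'a::{field,finite}) set)"
  by (simp add: torus_def finite_PiE)

lemma int_card_torus:
  "int (card (torus s :: (nat \<Rightarrow> 'a::{field,finite}) set)) = (int CARD('a) - 1) ^ s"
  by (simp add: torus_def card_PiE int_card_units)

lemma torus_nonzero: "t \<in> torus s \<Longrightarrow> i \<in> {1..s} \<Longrightarrow> t i \<noteq> 0"
  by (auto simp: torus_def)

text \<open>Knowing \<open>t\<^sub>1\<close> and all the products \<open>l * t\<^sub>i * t\<^sub>i\<^sub>+\<^sub>1\<close> determines \<open>t\<^sub>3\<close>, \<open>t\<^sub>5\<close>, \<open>\<dots>\<close> in turn, because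
  \<open>l * t\<^sub>i\<^sub>+\<^sub>1\<close> is determined by \<open>t\<^sub>i\<close>, and \<open>t\<^sub>i\<^sub>+\<^sub>2\<close> by \<open>l * t\<^sub>i\<^sub>+\<^sub>1\<close>. As \<open>s\<close> is odd this reaches \<open>t\<^sub>s\<close>,
  and the closing product \<open>l * t\<^sub>s * t\<^sub>1\<close> reveals \<open>l\<close>, after which the remaining coordinates follow.\<close>

lemma scaled_cycle_products_determine:
  fixes t t' :: "nat \<Rightarrow> 'a::field"
  assumes "odd s"
    and t: "t \<in> torus s" and t': "t' \<in> torus s" and l: "l \<noteq> 0" "l' \<noteq> 0"
    and first: "t 1 = t' 1"
    and prods: "\<And>i. i \<in> {1..s} \<Longrightarrow> l * (t i * t (next_vertex s i)) = l' * (t' i * t' (next_vertex s i))"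
  shows "l = l'" and "t = t'"
proof -
  have nz: "t i \<noteq> 0" "t' i \<noteq> 0" if "1 \<le> i" "i \<le> s" for i
    using torus_nonzero[OF t, of i] torus_nonzero[OF t', of i] that by auto
  have prod_step: "l * (t i * t (Suc i)) = l' * (t' i * t' (Suc i))" if "1 \<le> i" "i < s" for i
    using prods[of i] that by (simp add: next_vertex_def)
  have odd_eq: "t (Suc (2 * k)) = t' (Suc (2 * k))" if "Suc (2 * k) \<le> s" for k
    using that
  proof (induction k)
    case 0
    then show ?case using first by simp
  next
    case (Suc k)
    let ?i = "Suc (2 * k)"
    have "t ?i = t' ?i" using Suc by simp
    then have "l * t (Suc ?i) = l' * t' (Suc ?i)"
      using prod_step[of ?i] nz[of ?i] Suc.prems by simp
    then show ?case
      using prod_step[of "Suc ?i"] nz[of "Suc ?i"] l Suc.prems by (simp flip: mult.assoc)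
  qed
  obtain k where k: "s = Suc (2 * k)" using \<open>odd s\<close> by (auto elim: oddE)
  have "t s = t' s" using odd_eq[of k] k by simp
  moreover have "l * (t s * t 1) = l' * (t' s * t' 1)"
    using prods[of s] k by (simp add: next_vertex_def)
  ultimately show "l = l'" using first nz[of s] nz[of 1] k by simp
  have "t i = t' i" if "1 \<le> i" "i \<le> s" for i
    using that
  proof (induction i rule: dec_induct)
    case base
    then show ?case using first by simp
  next
    case (step i)
    then show ?case
      using prod_step[of i] \<open>l = l'\<close> l nz[of i] by simp
  qed
  then show "t = t'"
    using t t' unfolding torus_def by (intro PiE_ext) auto
qed

text \<open>The map \<open>\<Phi>\<close> below is injective by the previous lemma, hence a permutation of a finite set. It
  turns the cycle form at \<open>t\<close> into \<open>l\<close> times itself, read as a linear form in the new coordinates.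
  The two sets of non-zeros thus become equinumerous after taking the product with the non-zero
  scalars, a factor that can be cancelled.\<close>

lemma card_cycle_form_nonzeros_eq_linear:
  fixes c :: "nat \<Rightarrow> 'a::{field,finite}"
  assumes "odd s"
  shows "card {t \<in> torus s. (\<Sum>i=1..s. c i * (t i * t (next_vertex s i))) \<noteq> 0} =
         card {y \<in> torus s. (\<Sum>i=1..s. c i * y i) \<noteq> 0}"
    (is "card ?A = card ?B")
proof -
  define U where "U = (UNIV - {0 :: 'a})"
  define \<Phi> where "\<Phi> = (\<lambda>(l :: 'a, t). (t 1, \<lambda>i\<in>{1..s}. l * (t i * t (next_vertex s i))))"
  have maps: "\<Phi> ` (U \<times> torus s) \<subseteq> U \<times> torus s"
  proof (rule image_subsetI)
    fix p :: "'a \<times> (nat \<Rightarrow> 'a)" assume "p \<in> U \<times> torus s"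
    then obtain l t where p: "p = (l, t)" "l \<noteq> 0" "t \<in> torus s" by (auto simp: U_def)
    have nz: "t i \<noteq> 0" if "i \<in> {1..s}" for i using p(3) that by (rule torus_nonzero)
    then have "(\<lambda>i\<in>{1..s}. l * (t i * t (next_vertex s i))) \<in> torus s"
      unfolding torus_def using p(2) next_vertex_range[of _ s] by (intro restrict_PiE_iff[THEN iffD2]) auto
    moreover have "t 1 \<noteq> 0" using nz[of 1] \<open>odd s\<close> by (cases s) auto
    ultimately show "\<Phi> p \<in> U \<times> torus s" by (simp add: \<Phi>_def U_def p(1))
  qed
  have inj: "inj_on \<Phi> (U \<times> torus s)"
  proof (rule inj_onI, clarify)
    fix l l' :: 'a and t t' :: "nat \<Rightarrow> 'a"
    assume *: "l \<in> U" "l' \<in> U" "t \<in> torus s" "t' \<in> torus s" "\<Phi> (l, t) = \<Phi> (l', t')"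
    have first: "t 1 = t' 1" using *(5) by (simp add: \<Phi>_def)
    have "l * (t i * t (next_vertex s i)) = l' * (t' i * t' (next_vertex s i))" if "i \<in> {1..s}" for i
    proof -
      have "snd (\<Phi> (l, t)) i = snd (\<Phi> (l', t')) i" using *(5) by simp
      then show ?thesis using that by (simp add: \<Phi>_def)
    qed
    note det = scaled_cycle_products_determine[OF \<open>odd s\<close> *(3,4) _ _ first this]
    show "l = l' \<and> t = t'" using det *(1,2) by (auto simp: U_def)
  qed
  have surj: "\<Phi> ` (U \<times> torus s) = U \<times> torus s"
    by (rule endo_inj_surj[OF _ maps inj]) (simp add: U_def finite_torus)
  have vanish: "(\<Sum>i=1..s. c i * snd (\<Phi> (l, t)) i) = l * (\<Sum>i=1..s. c i * (t i * t (next_vertex s i)))"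
    for l t unfolding sum_distrib_left by (intro sum.cong) (auto simp: \<Phi>_def mult_ac)
  have "\<Phi> ` (U \<times> ?A) = U \<times> ?B"
  proof (intro equalityI subsetI)
    fix p assume "p \<in> \<Phi> ` (U \<times> ?A)"
    then obtain l t where p: "p = \<Phi> (l, t)" "l \<in> U" "t \<in> ?A" by auto
    then have "p \<in> U \<times> torus s" using maps by blast
    moreover have "(\<Sum>i=1..s. c i * snd p i) \<noteq> 0"
      using p vanish[of l t] by (auto simp: U_def)
    ultimately show "p \<in> U \<times> ?B" by auto
  next
    fix p assume p: "p \<in> U \<times> ?B"
    then have "p \<in> \<Phi> ` (U \<times> torus s)" unfolding surj by auto
    then obtain l t where lt: "p = \<Phi> (l, t)" "l \<in> U" "t \<in> torus s" by auto
    then have "t \<in> ?A" using p vanish[of l t] by auto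
    then show "p \<in> \<Phi> ` (U \<times> ?A)" using lt by auto
  qed
  then have "card (U \<times> ?B) = card (U \<times> ?A)"
    using card_image[OF inj_on_subset[OF inj], of "U \<times> ?A"] by auto
  moreover have "card U > 0"
  proof -
    have "1 \<in> U" by (simp add: U_def)
    then show ?thesis by (auto simp: card_gt_0_iff)
  qed
  ultimately show ?thesis by (auto simp: card_cartesian_product)
qed

lemma card_cycle_form_nonzeros:
  fixes c :: "nat \<Rightarrow> 'a::{field,finite}"
  assumes "odd s"
  shows "int (card {t \<in> torus s. (\<Sum>i=1..s. c i * (t i * t (next_vertex s i))) \<noteq> 0}) =
         alt_sum (int CARD('a) - 1) s (card {i \<in> {1..s}. c i \<noteq> 0})"
  unfolding card_cycle_form_nonzeros_eq_linear[OF assms]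
  using card_linear_form_nonzeros[of "{1..s}" c] by (simp add: torus_def)


section \<open>Coordinates on the edge polynomials of a cycle\<close>

definition cycle_monomial :: "nat \<Rightarrow> nat \<Rightarrow> monomial" where
  "cycle_monomial s i = Poly_Mapping.single i 1 + Poly_Mapping.single (next_vertex s i) 1"

definition cycle_poly :: "nat \<Rightarrow> (nat \<Rightarrow> 'a::field) \<Rightarrow> 'a mpoly" where
  "cycle_poly s c = (\<Sum>i=1..s. Poly_Mapping.single (cycle_monomial s i) (c i))"

lemma next_vertex_neq: "s \<ge> 2 \<Longrightarrow> next_vertex s i \<noteq> i"
  by (auto simp: next_vertex_def)

lemma keys_cycle_monomial:
  assumes "s \<ge> 2"
  shows "Poly_Mapping.keys (cycle_monomial s i) = {i, next_vertex s i}"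
  using next_vertex_neq[OF assms, of i]
  by (auto simp: cycle_monomial_def in_keys_iff lookup_add lookup_single when_def split: if_splits)

text \<open>A cycle of length at least three has no repeated edge; for \<open>s = 2\<close> the two monomials
  coincide.\<close>

lemma inj_on_cycle_monomial:
  assumes "s \<ge> 3"
  shows "inj_on (cycle_monomial s) {1..s}"
proof (rule inj_onI)
  fix i j assume ij: "i \<in> {1..s}" "j \<in> {1..s}" "cycle_monomial s i = cycle_monomial s j"
  then have "{i, next_vertex s i} = {j, next_vertex s j}"
    using keys_cycle_monomial[of s i] keys_cycle_monomial[of s j] assms by simp
  then show "i = j" using ij(1,2) assms
    by (auto simp: next_vertex_def doubleton_eq_iff split: if_splits)
qed

lemma cycle_edges_eq:
  assumes "s \<ge> 1"
  shows "cycle_edges s = (\<lambda>i. {i, next_vertex s i}) ` {1..s}"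
proof (intro equalityI subsetI)
  fix e assume "e \<in> cycle_edges s"
  then consider i where "e = {i, i + 1}" "1 \<le> i" "i \<le> s - 1" | "e = {1, s}"
    by (auto simp: cycle_edges_def)
  then show "e \<in> (\<lambda>i. {i, next_vertex s i}) ` {1..s}"
  proof cases
    case 1
    then show ?thesis using assms by (intro image_eqI[of _ _ i]) (auto simp: next_vertex_def)
  next
    case 2
    then show ?thesis using assms by (intro image_eqI[of _ _ s]) (auto simp: next_vertex_def)
  qed
next
  fix e assume "e \<in> (\<lambda>i. {i, next_vertex s i}) ` {1..s}"
  then obtain i where i: "i \<in> {1..s}" "e = {i, next_vertex s i}" by auto
  then have "e = {1, s} \<or> (e = {i, i + 1} \<and> 1 \<le> i \<and> i \<le> s - 1)"
    by (auto simp: next_vertex_def)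
  then show "e \<in> cycle_edges s"
    unfolding cycle_edges_def by blast
qed

lemma edge_monomials_cycle:
  assumes "s \<ge> 2"
  shows "edge_monomials (cycle_edges s) = cycle_monomial s ` {1..s}"
proof (intro equalityI subsetI)
  fix m assume "m \<in> edge_monomials (cycle_edges s)"
  then obtain i j where m: "m = Poly_Mapping.single i 1 + Poly_Mapping.single j 1" "{i, j} \<in> cycle_edges s"
    by (auto simp: edge_monomials_def)
  then obtain k where "k \<in> {1..s}" "{i, j} = {k, next_vertex s k}"
    using cycle_edges_eq[of s] assms by auto
  then show "m \<in> cycle_monomial s ` {1..s}"
    using m(1) by (auto simp: cycle_monomial_def doubleton_eq_iff add.commute)
next
  fix m assume "m \<in> cycle_monomial s ` {1..s}"
  then obtain k where k: "k \<in> {1..s}" "m = cycle_monomial s k" by auto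
  then have "{k, next_vertex s k} \<in> cycle_edges s"
    using cycle_edges_eq[of s] assms by auto
  then show "m \<in> edge_monomials (cycle_edges s)"
    using k(2) next_vertex_neq[OF assms, of k] unfolding edge_monomials_def cycle_monomial_def
    by (intro CollectI exI[of _ k] exI[of _ "next_vertex s k"]) auto
qed

lemma mpoly_scale_single:
  "mpoly_scale c (Poly_Mapping.single m 1) = Poly_Mapping.single m c"
  by (simp add: mpoly_scale_def mult_single)

text \<open>Coefficient vectors are taken extensional, so that they are unique for each edge polynomial.\<close>

lemma edge_space_cycle:
  assumes "s \<ge> 3"
  shows "edge_space (cycle_edges s) = cycle_poly s ` ({1..s} \<rightarrow>\<^sub>E (UNIV :: 'a::field set))"
proof -
  interpret vector_space "mpoly_scale :: 'a \<Rightarrow> _" by (rule vector_space_mpoly)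
  define b where "b i = Poly_Mapping.single (cycle_monomial s i) (1 :: 'a)" for i
  have inj: "inj_on b {1..s}"
  proof (rule inj_onI)
    fix i j assume ij: "i \<in> {1..s}" "j \<in> {1..s}" "b i = b j"
    then have "Poly_Mapping.keys (b i) = Poly_Mapping.keys (b j)" by simp
    then have "cycle_monomial s i = cycle_monomial s j" by (simp add: b_def)
    then show "i = j" using inj_on_cycle_monomial[OF assms] ij by (auto dest: inj_onD)
  qed
  have b: "(\<lambda>m. Poly_Mapping.single m 1) ` edge_monomials (cycle_edges s) = b ` {1..s}"
    using assms by (auto simp: edge_monomials_cycle b_def)
  have comb: "(\<Sum>v\<in>b ` {1..s}. mpoly_scale (u v) v) = cycle_poly s (\<lambda>i. u (b i))" for u
    unfolding sum.reindex[OF inj] cycle_poly_def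
    by (intro sum.cong) (simp_all add: b_def mpoly_scale_single)
  have "edge_space (cycle_edges s) = range (\<lambda>u. \<Sum>v\<in>b ` {1..s}. mpoly_scale (u v) v)"
    unfolding edge_space_def b by (rule span_finite) simp
  also have "\<dots> = cycle_poly s ` ({1..s} \<rightarrow>\<^sub>E UNIV)"
  proof (intro equalityI subsetI)
    fix f assume "f \<in> range (\<lambda>u. \<Sum>v\<in>b ` {1..s}. mpoly_scale (u v) v)"
    then obtain u where "f = cycle_poly s (\<lambda>i. u (b i))" using comb by auto
    also have "\<dots> = cycle_poly s (\<lambda>i\<in>{1..s}. u (b i))"
      by (simp add: cycle_poly_def)
    finally show "f \<in> cycle_poly s ` ({1..s} \<rightarrow>\<^sub>E UNIV)" by auto
  next
    fix f assume "f \<in> cycle_poly s ` ({1..s} \<rightarrow>\<^sub>E (UNIV :: 'a set))"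
    then obtain c where f: "f = cycle_poly s c" by auto
    have "f = cycle_poly s (\<lambda>i. (c \<circ> the_inv_into {1..s} b) (b i))"
      unfolding f cycle_poly_def using the_inv_into_f_f[OF inj]
      by (intro sum.cong) auto
    then show "f \<in> range (\<lambda>u. \<Sum>v\<in>b ` {1..s}. mpoly_scale (u v) v)"
      unfolding comb by blast
  qed
  finally show ?thesis .
qed

lemma lookup_cycle_poly:
  assumes "s \<ge> 3" "i \<in> {1..s}"
  shows "Poly_Mapping.lookup (cycle_poly s c) (cycle_monomial s i) = c i"
proof -
  have "Poly_Mapping.lookup (cycle_poly s c) (cycle_monomial s i) =
      (\<Sum>j=1..s. if j = i then c j else 0)"
    unfolding cycle_poly_def lookup_sum
  proof (intro sum.cong refl)
    fix j assume "j \<in> {1..s}"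
    then have "cycle_monomial s j = cycle_monomial s i \<longleftrightarrow> j = i"
      using inj_on_eq_iff[OF inj_on_cycle_monomial[OF assms(1)]] assms(2) by blast
    then show "Poly_Mapping.lookup (Poly_Mapping.single (cycle_monomial s j) (c j)) (cycle_monomial s i) =
        (if j = i then c j else 0)"
      by (simp add: lookup_single when_def)
  qed
  then show ?thesis using assms(2) by simp
qed

lemma num_nonzero_terms_cycle_poly:
  assumes "s \<ge> 3"
  shows "num_nonzero_terms (cycle_edges s) (cycle_poly s c) = card {i \<in> {1..s}. c i \<noteq> 0}"
proof -
  have "{m \<in> edge_monomials (cycle_edges s). Poly_Mapping.lookup (cycle_poly s c) m \<noteq> 0} =
      cycle_monomial s ` {i \<in> {1..s}. c i \<noteq> 0}"
    using assms lookup_cycle_poly[OF assms, of _ c] by (auto simp: edge_monomials_cycle)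
  then show ?thesis
    using inj_on_cycle_monomial[OF assms]
    by (auto simp: num_nonzero_terms_def intro!: card_image intro: inj_on_subset)
qed

lemma mpoly_eval_cycle_poly:
  assumes "s \<ge> 3"
  shows "mpoly_eval P (cycle_poly s c) = (\<Sum>i=1..s. c i * (P i * P (next_vertex s i)))"
proof -
  define f where "f = cycle_poly s c"
  define val where "val m = (\<Prod>v\<in>Poly_Mapping.keys m. P v ^ Poly_Mapping.lookup m v)" for m
  have "Poly_Mapping.keys f \<subseteq> cycle_monomial s ` {1..s}"
  proof -
    have "Poly_Mapping.keys f \<subseteq> (\<Union>i\<in>{1..s}. Poly_Mapping.keys (Poly_Mapping.single (cycle_monomial s i) (c i)))"
      unfolding f_def cycle_poly_def by (rule Poly_Mapping.keys_sum)
    then show ?thesis by (auto split: if_splits)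
  qed
  then have "mpoly_eval P f = (\<Sum>m\<in>cycle_monomial s ` {1..s}. Poly_Mapping.lookup f m * val m)"
    unfolding mpoly_eval_def val_def by (intro sum.mono_neutral_left) (auto simp: in_keys_iff)
  also have "\<dots> = (\<Sum>i=1..s. c i * val (cycle_monomial s i))"
    unfolding sum.reindex[OF inj_on_cycle_monomial[OF assms]] f_def
    by (intro sum.cong) (simp_all add: lookup_cycle_poly[OF assms])
  also have "\<dots> = (\<Sum>i=1..s. c i * (P i * P (next_vertex s i)))"
  proof (intro sum.cong refl)
    fix i
    have "i \<noteq> next_vertex s i" using next_vertex_neq[of s i] assms by simp
    then show "c i * val (cycle_monomial s i) = c i * (P i * P (next_vertex s i))"
      using assms unfolding val_def
      by (simp add: keys_cycle_monomial) (simp add: cycle_monomial_def lookup_add lookup_single)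
  qed
  finally show ?thesis unfolding f_def .
qed


section \<open>Weights of codewords\<close>

lemma hamming_weight_evaluation_word:
  assumes "distinct Ps"
  shows "hamming_weight (evaluation_word Ps f) = card {P \<in> set Ps. mpoly_eval P f \<noteq> 0}"
proof -
  have "{P \<in> set Ps. mpoly_eval P f \<noteq> 0} = (!) Ps ` {i. i < length Ps \<and> mpoly_eval (Ps ! i) f \<noteq> 0}"
    by (auto simp: in_set_conv_nth)
  moreover have "inj_on ((!) Ps) {i. i < length Ps \<and> mpoly_eval (Ps ! i) f \<noteq> 0}"
    using assms by (auto simp: inj_on_def nth_eq_iff_index_eq)
  ultimately have "card {P \<in> set Ps. mpoly_eval P f \<noteq> 0} =
      card {i. i < length Ps \<and> mpoly_eval (Ps ! i) f \<noteq> 0}"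
    by (simp add: card_image)
  also have "{i. i < length Ps \<and> mpoly_eval (Ps ! i) f \<noteq> 0} =
      {i. i < length (evaluation_word Ps f) \<and> evaluation_word Ps f ! i \<noteq> 0}"
    by (auto simp: evaluation_word_def)
  finally show ?thesis by (simp add: hamming_weight_def)
qed

lemma card_nonzeros_cycle_poly:
  fixes c :: "nat \<Rightarrow> 'a::{field,finite}"
  assumes "s \<ge> 3" "odd s"
  shows "int (card {P \<in> torus s. mpoly_eval P (cycle_poly s c) \<noteq> 0}) =
         alt_sum (int CARD('a) - 1) s (card {i \<in> {1..s}. c i \<noteq> 0})"
  using card_cycle_form_nonzeros[OF assms(2), of c] assms by (simp add: mpoly_eval_cycle_poly)

lemma card_torus_zeros:
  fixes f :: "'a::{field,finite} mpoly"
  shows "int (card (torus_zeros s f)) =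
    (int CARD('a) - 1) ^ s - int (card {P \<in> torus s. mpoly_eval P f \<noteq> 0})"
proof -
  have "card (torus_zeros s f) + card {P \<in> torus s. mpoly_eval P f \<noteq> 0} = card (torus s :: (nat \<Rightarrow> 'a) set)"
  proof -
    let ?N = "{P \<in> torus s. mpoly_eval P f \<noteq> 0}"
    have "finite (torus_zeros s f)" "finite ?N" "torus_zeros s f \<inter> ?N = {}"
        "torus_zeros s f \<union> ?N = torus s"
      unfolding torus_zeros_def using finite_torus[of s, where 'a = 'a] by auto
    then show ?thesis using card_Un_disjoint[of "torus_zeros s f" ?N] by simp
  qed
  then show ?thesis using int_card_torus[of s, where 'a = 'a] by linarith
qed

text \<open>Two edge polynomials with the same word differ by an edge polynomial that vanishes on the
  whole torus; as non-zero edge polynomials have positive weight, this difference is zero.\<close>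

lemma inj_on_cycle_codeword:
  assumes "s \<ge> 3" "odd s" "CARD('a::{field,finite}) > 2" "set Ps = (torus s :: (nat \<Rightarrow> 'a) set)"
  shows "inj_on (\<lambda>c. evaluation_word Ps (cycle_poly s c)) ({1..s} \<rightarrow>\<^sub>E (UNIV :: 'a set))"
proof (rule inj_onI)
  fix c d :: "nat \<Rightarrow> 'a"
  assume cd: "c \<in> {1..s} \<rightarrow>\<^sub>E UNIV" "d \<in> {1..s} \<rightarrow>\<^sub>E UNIV"
    and eq: "evaluation_word Ps (cycle_poly s c) = evaluation_word Ps (cycle_poly s d)"
  define e where "e i = c i - d i" for i
  define r where "r = card {i \<in> {1..s}. e i \<noteq> 0}"
  have "mpoly_eval P (cycle_poly s e) = 0" if "P \<in> torus s" for P
  proof -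
    have "mpoly_eval P (cycle_poly s c) = mpoly_eval P (cycle_poly s d)"
      using eq that assms(4) by (auto simp: evaluation_word_def)
    then show ?thesis using assms(1)
      by (simp add: mpoly_eval_cycle_poly e_def left_diff_distrib sum_subtractf)
  qed
  then have "{P \<in> torus s. mpoly_eval P (cycle_poly s e) \<noteq> 0} = {}" by auto
  then have "alt_sum (int CARD('a) - 1) s r = 0"
    unfolding r_def card_nonzeros_cycle_poly[OF assms(1,2), symmetric] by (simp only: card.empty of_nat_0)
  moreover have "r \<le> s"
    unfolding r_def by (rule order_trans[OF card_mono[of "{1..s}"]]) auto
  ultimately have "r = 0"
    using alt_sum_pos[of "int CARD('a) - 1" r s] assms(3) by (cases "r = 0") auto
  then have "e i = 0" if "i \<in> {1..s}" for i
    using that by (auto simp: r_def)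
  then show "c = d" using cd by (intro PiE_ext[OF cd]) (auto simp: e_def)
qed

text \<open>The functions are sorted by their support: for a fixed support \<open>A\<close> they form the product \<open>F A\<close> of
  the non-zero scalars over \<open>A\<close> with \<open>{0}\<close> outside \<open>A\<close>.\<close>

lemma card_functions_with_support_size:
  fixes S :: "'b set"
  assumes "finite S"
  shows "card {c \<in> S \<rightarrow>\<^sub>E (UNIV :: 'a::{field,finite} set). card {i \<in> S. c i \<noteq> 0} = r} =
         (card S choose r) * (CARD('a) - 1) ^ r"
proof -
  define F where "F A = (\<Pi>\<^sub>E i\<in>S. if i \<in> A then UNIV - {0 :: 'a} else {0})" for A
  define \<A> where "\<A> = {A. A \<subseteq> S \<and> card A = r}"
  have supp: "{i \<in> S. c i \<noteq> 0} = A" if "c \<in> F A" "A \<subseteq> S" for c A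
    using that by (auto simp: F_def PiE_iff split: if_splits)
  have mem: "c \<in> F {i \<in> S. c i \<noteq> 0}" if "c \<in> S \<rightarrow>\<^sub>E UNIV" for c
    using that by (auto simp: F_def PiE_iff)
  have "{c \<in> S \<rightarrow>\<^sub>E (UNIV :: 'a set). card {i \<in> S. c i \<noteq> 0} = r} = (\<Union>A\<in>\<A>. F A)"
  proof (intro equalityI subsetI)
    fix c :: "'b \<Rightarrow> 'a" assume "c \<in> (\<Union>A\<in>\<A>. F A)"
    then obtain A where A: "A \<subseteq> S" "card A = r" "c \<in> F A" by (auto simp: \<A>_def)
    then show "c \<in> {c \<in> S \<rightarrow>\<^sub>E UNIV. card {i \<in> S. c i \<noteq> 0} = r}"
      using supp[OF A(3,1)] by (auto simp: F_def PiE_iff)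
  next
    fix c :: "'b \<Rightarrow> 'a" assume "c \<in> {c \<in> S \<rightarrow>\<^sub>E UNIV. card {i \<in> S. c i \<noteq> 0} = r}"
    then show "c \<in> (\<Union>A\<in>\<A>. F A)"
      using mem[of c] by (intro UN_I[of "{i \<in> S. c i \<noteq> 0}"]) (auto simp: \<A>_def)
  qed
  also have "card \<dots> = (\<Sum>A\<in>\<A>. card (F A))"
  proof (rule card_UN_disjoint)
    show "finite \<A>" using assms by (simp add: \<A>_def)
    show "\<forall>A\<in>\<A>. finite (F A)" using assms by (auto simp: F_def intro!: finite_PiE)
    show "\<forall>A\<in>\<A>. \<forall>B\<in>\<A>. A \<noteq> B \<longrightarrow> F A \<inter> F B = {}"
    proof (intro ballI impI, rule ccontr)
      fix A B assume AB: "A \<in> \<A>" "B \<in> \<A>" "A \<noteq> B" "F A \<inter> F B \<noteq> {}"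
      then obtain c where "c \<in> F A" "c \<in> F B" by auto
      then show False using supp[of c A] supp[of c B] AB(1,2,3) by (simp add: \<A>_def)
    qed
  qed
  also have "\<dots> = (\<Sum>A\<in>\<A>. (CARD('a) - 1) ^ r)"
  proof (intro sum.cong refl)
    fix A assume A: "A \<in> \<A>"
    have "card (F A) = (\<Prod>i\<in>S. if i \<in> A then CARD('a) - 1 else 1)"
      unfolding F_def using assms by (subst card_PiE) (auto intro!: prod.cong simp: card_Diff_singleton)
    also have "\<dots> = (CARD('a) - 1) ^ card {i \<in> S. i \<in> A}"
      using assms by (simp flip: prod.inter_filter)
    also have "{i \<in> S. i \<in> A} = A" using A by (auto simp: \<A>_def)
    finally show "card (F A) = (CARD('a) - 1) ^ r" using A by (simp add: \<A>_def)
  qed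
  also have "\<dots> = (card S choose r) * (CARD('a) - 1) ^ r"
    using n_subsets[OF assms, of r] by (simp add: \<A>_def)
  finally show ?thesis .
qed


section \<open>The weight distribution\<close>

theorem theorem4p3:
  fixes q s :: nat and Ps :: "(nat \<Rightarrow> 'a::{field,finite}) list"
  assumes "primepow q" and "q > 2" and "CARD('a) = q"
    and "s \<ge> 3" and "odd s"
    and "distinct Ps" and "set Ps = torus s"
  shows "(\<forall>f \<in> (edge_space (cycle_edges s) :: 'a mpoly set). \<forall>r \<in> {1..s}.
            num_nonzero_terms (cycle_edges s) f = r \<longrightarrow>
            int (card (torus_zeros s f)) =
              (\<Sum>i=1..r - 1. (- 1) ^ (i + 1) * (int q - 1) ^ (s - i))) \<and>
         (\<forall>r \<in> {1..s}.
            weight_count (edge_code Ps (cycle_edges s)) (cycle_weight q s r) =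
              (s choose r) * (q - 1) ^ r) \<and>
         (\<forall>j \<ge> 1. j \<notin> cycle_weight q s ` {1..s} \<longrightarrow>
            weight_count (edge_code Ps (cycle_edges s)) j = 0) \<and>
         min_distance (edge_code Ps (cycle_edges s)) = cycle_weight q s 2 \<and>
         min_distance (edge_code Ps (cycle_edges s)) = (q - 1) ^ (s - 1) * (q - 2) \<and>
         (\<forall>f \<in> edge_space (cycle_edges s).
            num_nonzero_terms (cycle_edges s) f = 2 \<longrightarrow>
            hamming_weight (evaluation_word Ps f) = min_distance (edge_code Ps (cycle_edges s)))"
proof -
  let ?E = "cycle_edges s"
  let ?C = "edge_code Ps ?E"
  let ?V = "{1..s} \<rightarrow>\<^sub>E (UNIV :: 'a set)"
  define n where "n = int q - 1"
  have n2: "n \<ge> 2" using assms(2) by (simp add: n_def)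
  define supp where "supp c = card {i \<in> {1..s}. c i \<noteq> 0}" for c :: "nat \<Rightarrow> 'a"
  define word where "word c = evaluation_word Ps (cycle_poly s c)" for c
  have supp_le: "supp c \<le> s" for c
    unfolding supp_def by (rule order_trans[OF card_mono[of "{1..s}"]]) auto
  have space: "edge_space ?E = cycle_poly s ` ?V"
    by (rule edge_space_cycle[OF \<open>s \<ge> 3\<close>])
  have terms: "num_nonzero_terms ?E (cycle_poly s c) = supp c" for c
    unfolding supp_def by (rule num_nonzero_terms_cycle_poly[OF \<open>s \<ge> 3\<close>])
  have nonzeros: "int (card {P \<in> torus s. mpoly_eval P (cycle_poly s c) \<noteq> 0}) = alt_sum n s (supp c)" for c
    unfolding supp_def n_def using card_nonzeros_cycle_poly[OF \<open>s \<ge> 3\<close> \<open>odd s\<close>, of c] assms(3) by simp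
  have weight: "int (hamming_weight (word c)) = alt_sum n s (supp c)" for c
    unfolding word_def hamming_weight_evaluation_word[OF \<open>distinct Ps\<close>] \<open>set Ps = torus s\<close>
    by (rule nonzeros)
  \<comment> \<open>From here on, codewords are counted through their coefficient vectors.\<close>
  have inj: "inj_on word ?V"
    unfolding word_def using inj_on_cycle_codeword[OF \<open>s \<ge> 3\<close> \<open>odd s\<close> _ \<open>set Ps = torus s\<close>] assms(2,3)
    by simp
  have code: "?C = word ` ?V"
    unfolding edge_code_def space word_def by (simp add: image_image)
  have cw: "int (cycle_weight q s r) = alt_sum n s r" if "r \<in> {1..s}" for r
    using alt_sum_pos[OF n2, of r s] cycle_weight_eq_alt_sum[of r q s] that by (simp add: n_def)
  have count: "weight_count ?C j = card {c \<in> ?V. alt_sum n s (supp c) = int j}" for j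
  proof -
    have "{w \<in> ?C. hamming_weight w = j} = word ` {c \<in> ?V. alt_sum n s (supp c) = int j}"
      unfolding code using weight by (auto simp flip: weight)
    then show ?thesis unfolding weight_count_def
      using inj by (auto intro!: card_image intro: inj_on_subset)
  qed
  have zeros: "int (card (torus_zeros s f)) = (\<Sum>i=1..r - 1. (- 1) ^ (i + 1) * (int q - 1) ^ (s - i))"
    if f: "f \<in> edge_space ?E" and r: "r \<in> {1..s}" "num_nonzero_terms ?E f = r" for f :: "'a mpoly" and r
  proof -
    obtain c where c: "f = cycle_poly s c" using f space by auto
    have "int (card (torus_zeros s f)) = n ^ s - alt_sum n s r"
      unfolding card_torus_zeros c nonzeros using r terms c assms(3) by (simp add: n_def)
    also have "alt_sum n s r = n ^ s + (\<Sum>i=1..r - 1. (- 1) ^ i * n ^ (s - i))"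
    proof -
      have "{..<r} = insert 0 {1..r - 1}" using r by auto
      then show ?thesis by (simp add: alt_sum_def)
    qed
    finally show ?thesis by (simp add: n_def sum_negf)
  qed
  have dist: "weight_count ?C (cycle_weight q s r) = (s choose r) * (q - 1) ^ r" if r: "r \<in> {1..s}" for r
  proof -
    have "alt_sum n s (supp c) = alt_sum n s r \<longleftrightarrow> supp c = r" for c
      using inj_on_alt_sum[OF n2, of s] supp_le[of c] r by (auto simp: inj_on_eq_iff)
    then have "weight_count ?C (cycle_weight q s r) = card {c \<in> ?V. supp c = r}"
      unfolding count cw[OF r] by simp
    also have "\<dots> = (s choose r) * (q - 1) ^ r"
      unfolding supp_def using card_functions_with_support_size[of "{1..s}" r, where 'a = 'a] assms(3)
      by simp
    finally show ?thesis .
  qed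
  have rest: "weight_count ?C j = 0" if j: "j \<ge> 1" "j \<notin> cycle_weight q s ` {1..s}" for j
  proof -
    \<comment> \<open>The zero word is excluded by \<open>j \<ge> 1\<close>, and all other words have a listed weight.\<close>
    have "alt_sum n s (supp c) \<noteq> int j" for c
    proof
      assume eq: "alt_sum n s (supp c) = int j"
      then have "supp c \<in> {1..s}" using j(1) supp_le[of c] by (cases "supp c") auto
      then show False using cw[of "supp c"] eq j(2) by auto
    qed
    then show ?thesis unfolding count by simp
  qed
  have two: "2 \<in> {1..s}" using \<open>s \<ge> 3\<close> by simp
  have min: "min_distance ?C = cycle_weight q s 2"
    unfolding min_distance_def
  proof (rule Least_equality)
    have "cycle_weight q s 2 \<ge> 1"
      using cw[OF two] alt_sum_pos[OF n2, of 2 s] two by simp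
    moreover have "weight_count ?C (cycle_weight q s 2) \<noteq> 0"
      unfolding dist[OF two] using assms(2) two by simp
    ultimately show "1 \<le> cycle_weight q s 2 \<and> weight_count ?C (cycle_weight q s 2) \<noteq> 0" ..
  next
    fix j assume "1 \<le> j \<and> weight_count ?C j \<noteq> 0"
    then have "j \<in> cycle_weight q s ` {1..s}" using rest[of j] by auto
    then obtain r where r: "r \<in> {1..s}" "j = cycle_weight q s r" by auto
    then show "cycle_weight q s 2 \<le> j"
      using alt_sum_2_le[OF n2, of r s] two cw[OF two] cw[OF r(1)] by simp
  qed
  have value2: "cycle_weight q s 2 = (q - 1) ^ (s - 1) * (q - 2)"
  proof -
    have "int (cycle_weight q s 2) = n ^ (s - 1) * (n - 1)"
      using cw[OF two] alt_sum_2[of s n] \<open>s \<ge> 3\<close> by simp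
    also have "\<dots> = int ((q - 1) ^ (s - 1) * (q - 2))"
      using assms(2) by (simp add: n_def of_nat_diff)
    finally show ?thesis by (simp only: of_nat_eq_iff)
  qed
  have attained: "hamming_weight (evaluation_word Ps f) = min_distance ?C"
    if f: "f \<in> edge_space ?E" "num_nonzero_terms ?E f = 2" for f :: "'a mpoly"
  proof -
    obtain c where c: "f = cycle_poly s c" using f space by auto
    then have "int (hamming_weight (evaluation_word Ps f)) = int (cycle_weight q s 2)"
      using weight[of c] terms[of c] f(2) cw[OF two] by (simp add: word_def)
    then show ?thesis using min by simp
  qed
  show ?thesis
    using zeros dist rest min value2 attained by simp
qed

end
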